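(* Let $(X,S)$ be a nondegenerate symmetric set, and write $S(x,y)=(g_x(y),f_y(x))$. Let $J_n:X^n\to X^n$ be the map $$J_n(x_1,\dots,x_n)=\bigl(f_{x_n}f_{x_{n-1}}\cdots f_{x_2}(x_1),\ f_{x_n}\cdots f_{x_3}(x_2),\ \dots,\ f_{x_n}(x_{n-1}),\ x_n\bigr).$$ Then $J_n$ conjugates the twisted action of the symmetric group $S_n$ on $X^n$ to the canonical action of $S_n$ on $X^n$ by permutations of components. Thus the two actions of $S_n$ on $X^n$ are isomorphic.
   Context: Let $X$ be a nonempty set and $S:X\times X\to X\times X$ a bijection, $S(x,y)=(S_1(x,y),S_2(x,y))$. $(X,S)$ is nondegenerate if for all fixed $y,z\in X$ the maps $x\mapsto S_2(x,y)$ and $x\mapsto S_1(z,x)$ are bijections $X\to X$. For $1\le i<n$ put $S^{i,i+1}=\mathrm{id}_{X^{i-1}}\times S\times \mathrm{id}_{X^{n-i-1}}:X^n\to X^n$. $(X,S)$ is a braided set if $S^{12}S^{23}S^{12}=S^{23}S^{12}S^{23}$ on $X^3$, involutive if $S^2=\mathrm{id}$, and a symmetric set if it is braided and involutive. For a symmetric set, the twisted action of $S_n$ on $X^n$ is the action in which the adjacent transposition $b_i=(i\ i+1)$ acts by $S^{i,i+1}$. In the canonical action, $b_i$ acts by exchanging the $i$-th and $(i+1)$-th components. *)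

theory Defs
  imports "HOL-Algebra.Sym_Groups" "HOL-Algebra.Group_Action"
begin

text \<open>
  \<open>X^n\<close> is the set of extensional functions on \<open>{1..n}\<close> with values in \<open>X\<close>, so that components
  are numbered as in \<^const>\<open>sym_group\<close> and maps \<open>X^n \<rightarrow> X^n\<close> can be elements of \<^const>\<open>BijGroup\<close>.
\<close>

definition cpow :: "'a set \<Rightarrow> nat \<Rightarrow> (nat \<Rightarrow> 'a) set"
  where "cpow X n = {1..n} \<rightarrow>\<^sub>E X"

text \<open>\<open>S (x, y) = (g\<^sub>x y, f\<^sub>y x)\<close>; note that the index of \<open>f\<close> is the second argument of \<open>S\<close>.\<close>

definition g_map :: "('a \<times> 'a \<Rightarrow> 'a \<times> 'a) \<Rightarrow> 'a \<Rightarrow> 'a \<Rightarrow> 'a"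
  where "g_map S x y = fst (S (x, y))"

definition f_map :: "('a \<times> 'a \<Rightarrow> 'a \<times> 'a) \<Rightarrow> 'a \<Rightarrow> 'a \<Rightarrow> 'a"
  where "f_map S y x = snd (S (x, y))"

definition nondegenerate :: "'a set \<Rightarrow> ('a \<times> 'a \<Rightarrow> 'a \<times> 'a) \<Rightarrow> bool"
  where "nondegenerate X S \<longleftrightarrow>
    (\<forall>y\<in>X. bij_betw (f_map S y) X X) \<and> (\<forall>z\<in>X. bij_betw (g_map S z) X X)"

definition S_adj :: "'a set \<Rightarrow> ('a \<times> 'a \<Rightarrow> 'a \<times> 'a) \<Rightarrow> nat \<Rightarrow> nat \<Rightarrow> (nat \<Rightarrow> 'a) \<Rightarrow> nat \<Rightarrow> 'a"
  where "S_adj X S n i = (\<lambda>x\<in>cpow X n.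
    x(i := fst (S (x i, x (Suc i))), Suc i := snd (S (x i, x (Suc i)))))"

definition braided :: "'a set \<Rightarrow> ('a \<times> 'a \<Rightarrow> 'a \<times> 'a) \<Rightarrow> bool"
  where "braided X S \<longleftrightarrow>
    (\<forall>x\<in>cpow X 3. S_adj X S 3 1 (S_adj X S 3 2 (S_adj X S 3 1 x))
                 = S_adj X S 3 2 (S_adj X S 3 1 (S_adj X S 3 2 x)))"

definition involutive :: "'a set \<Rightarrow> ('a \<times> 'a \<Rightarrow> 'a \<times> 'a) \<Rightarrow> bool"
  where "involutive X S \<longleftrightarrow> (\<forall>p\<in>X \<times> X. S (S p) = p)"

definition symmetric_set :: "'a set \<Rightarrow> ('a \<times> 'a \<Rightarrow> 'a \<times> 'a) \<Rightarrow> bool"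
  where "symmetric_set X S \<longleftrightarrow> braided X S \<and> involutive X S"

text \<open>
  The adjacent transpositions generate the symmetric group, so an action satisfying the following
  predicate is unique on the carrier of \<^term>\<open>sym_group n\<close>.
\<close>

definition is_twisted_action ::
    "'a set \<Rightarrow> ('a \<times> 'a \<Rightarrow> 'a \<times> 'a) \<Rightarrow> nat \<Rightarrow> ((nat \<Rightarrow> nat) \<Rightarrow> (nat \<Rightarrow> 'a) \<Rightarrow> nat \<Rightarrow> 'a) \<Rightarrow> bool"
  where "is_twisted_action X S n \<tau> \<longleftrightarrow>
    group_action (sym_group n) (cpow X n) \<tau> \<and>
    (\<forall>i\<in>{1..<n}. \<tau> (transpose i (Suc i)) = S_adj X S n i)"

text \<open>The inverse makes this a left action, as \<^const>\<open>group_action\<close> requires.\<close>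

definition canonical_action :: "'a set \<Rightarrow> nat \<Rightarrow> (nat \<Rightarrow> nat) \<Rightarrow> (nat \<Rightarrow> 'a) \<Rightarrow> nat \<Rightarrow> 'a"
  where "canonical_action X n \<sigma> = (\<lambda>x\<in>cpow X n. \<lambda>i\<in>{1..n}. x (inv' \<sigma> i))"

lemma canonical_action_adjacent:
  assumes "i \<in> {1..<n}" "x \<in> cpow X n"
  shows "canonical_action X n (transpose i (Suc i)) x = x(i := x (Suc i), Suc i := x i)"
  using assms
  by (auto simp: canonical_action_def cpow_def transpose_def fun_eq_iff PiE_def extensional_def)

text \<open>
  Since \<^const>\<open>fold\<close> consumes its list from the left, \<open>f\<close> indexed by \<open>x (i+1)\<close> is applied first and
  \<open>f\<close> indexed by \<open>x n\<close> last; for \<open>i = n\<close> the list is empty.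
\<close>

definition J_map :: "'a set \<Rightarrow> ('a \<times> 'a \<Rightarrow> 'a \<times> 'a) \<Rightarrow> nat \<Rightarrow> (nat \<Rightarrow> 'a) \<Rightarrow> nat \<Rightarrow> 'a"
  where "J_map X S n = (\<lambda>x\<in>cpow X n. \<lambda>i\<in>{1..n}. fold (\<lambda>j. f_map S (x j)) [Suc i..<Suc n] (x i))"

definition conjugates_action ::
    "('g, 'm) monoid_scheme \<Rightarrow> 'b set \<Rightarrow> ('g \<Rightarrow> 'b \<Rightarrow> 'b) \<Rightarrow> 'c set \<Rightarrow> ('g \<Rightarrow> 'c \<Rightarrow> 'c) \<Rightarrow> ('b \<Rightarrow> 'c) \<Rightarrow> bool"
  where "conjugates_action G E \<phi> F \<psi> h \<longleftrightarrow>
    group_action G E \<phi> \<and> group_action G F \<psi> \<and> bij_betw h E F \<and>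
    (\<forall>g\<in>carrier G. \<forall>x\<in>E. h (\<phi> g x) = \<psi> g (h x))"

definition isomorphic_actions ::
    "('g, 'm) monoid_scheme \<Rightarrow> 'b set \<Rightarrow> ('g \<Rightarrow> 'b \<Rightarrow> 'b) \<Rightarrow> 'c set \<Rightarrow> ('g \<Rightarrow> 'c \<Rightarrow> 'c) \<Rightarrow> bool"
  where "isomorphic_actions G E \<phi> F \<psi> \<longleftrightarrow> (\<exists>h. conjugates_action G E \<phi> F \<psi> h)"

end

theory Submission
  imports Defs
begin

text \<open>
  Everything rests on two facts about \<open>J = J_map X S n\<close>. First, \<open>J\<close> is a bijection: component \<open>i\<close> of
  \<open>J x\<close> is the image of \<open>x i\<close> under a bijection of \<open>X\<close> that depends only on the components to the
  right of \<open>i\<close>, so the system \<open>J x = y\<close> is triangular and is solved uniquely from right to left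
  (\<open>bij_betw_J_map\<close>). Second, \<open>J\<close> turns each \<open>S\<^bsup>i,i+1\<^esup>\<close> into the exchange of components \<open>i\<close> and
  \<open>i + 1\<close> (\<open>J_map_S_adj\<close>). Here component \<open>i\<close> is handled by involutivity, and the components to
  the left of \<open>i\<close> by the third component of the braid relation, which says
  \<open>f\<^sub>c f\<^sub>b = f\<^sub>d f\<^sub>e\<close> whenever \<open>S (b, c) = (e, d)\<close>.

  The twisted action can therefore be \<^emph>\<open>defined\<close> as the canonical action pulled back along \<open>J\<close>: on
  adjacent transpositions it is \<open>J\<inverse> (i i+1) J = S\<^bsup>i,i+1\<^esup>\<close>. This gives existence without the
  Coxeter presentation of the symmetric group. Conversely, since adjacent transpositions generate
  the symmetric group, the second fact implies that \<open>J\<close> intertwines any twisted action with the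
  canonical one.
\<close>

section \<open>Group actions\<close>

text \<open>
  The maps \<open>\<phi> g\<close> are bijective because the action laws make \<open>\<phi> (inv g)\<close> a two-sided inverse of
  \<open>\<phi> g\<close>; only the pointwise laws are left to check.
\<close>

lemma group_actionI:
  fixes G (structure)
  assumes "group G"
    and ext: "\<And>g. g \<in> carrier G \<Longrightarrow> \<phi> g \<in> extensional E"
    and closed: "\<And>g x. g \<in> carrier G \<Longrightarrow> x \<in> E \<Longrightarrow> \<phi> g x \<in> E"
    and one: "\<And>x. x \<in> E \<Longrightarrow> \<phi> \<one> x = x"
    and mult: "\<And>g h x. g \<in> carrier G \<Longrightarrow> h \<in> carrier G \<Longrightarrow> x \<in> E \<Longrightarrow> \<phi> (g \<otimes> h) x = \<phi> g (\<phi> h x)"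
  shows "group_action G E \<phi>"
proof -
  interpret group G by fact
  have bij: "\<phi> g \<in> Bij E" if g: "g \<in> carrier G" for g
  proof -
    have "\<phi> g (\<phi> (inv g) x) = x" "\<phi> (inv g) (\<phi> g x) = x" if "x \<in> E" for x
      using mult[of g "inv g" x] mult[of "inv g" g x] g that one by simp_all
    then have "bij_betw (\<phi> g) E E"
      using g closed by (intro bij_betw_byWitness[where f' = "\<phi> (inv g)"]) auto
    then show ?thesis
      using ext g by (simp add: Bij_def)
  qed
  have "\<phi> (g \<otimes> h) = compose E (\<phi> g) (\<phi> h)" if "g \<in> carrier G" "h \<in> carrier G" for g h
    using that mult ext by (intro extensionalityI[of _ E]) (auto simp: compose_def)
  then have "\<phi> \<in> hom G (BijGroup E)"
    using bij by (auto simp: hom_def BijGroup_def)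
  then show ?thesis
    by (simp add: group_action_def group_hom_def group_hom_axioms_def group_BijGroup \<open>group G\<close>)
qed

lemma group_action_pullback:
  assumes act: "group_action G F \<psi>" and h: "bij_betw h E F"
  shows "group_action G E (\<lambda>g. \<lambda>x\<in>E. inv_into E h (\<psi> g (h x)))"
proof -
  interpret group_action G F \<psi> by fact
  have grp: "group G"
    using group_hom group_hom.axioms(1) by blast
  then interpret group G .
  have hF: "h x \<in> F" if "x \<in> E" for x
    using h that by (auto simp: bij_betw_def)
  have \<psi>F: "\<psi> g y \<in> F" if "g \<in> carrier G" "y \<in> F" for g y
    using element_image that by blast
  have iE: "inv_into E h y \<in> E" if "y \<in> F" for y
    using h that by (metis bij_betw_def inv_into_into)
  have hi: "h (inv_into E h y) = y" if "y \<in> F" for y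
    using h that by (simp add: bij_betw_inv_into_right)
  have ih: "inv_into E h (h x) = x" if "x \<in> E" for x
    using h that by (simp add: bij_betw_inv_into_left)
  have one: "\<psi> \<one>\<^bsub>G\<^esub> y = y" if "y \<in> F" for y
    using that by (simp flip: id_eq_one)
  show ?thesis
    by (rule group_actionI[OF grp]) (simp_all add: hF \<psi>F iE hi ih one composition_rule)
qed

section \<open>Adjacent transpositions generate the symmetric group\<close>

text \<open>
  A permutation is a product of transpositions, and a transposition \<open>(a b)\<close> is a product of adjacent
  ones that exchange only numbers between \<open>a\<close> and \<open>b\<close>, so the factors stay within \<open>{1..n}\<close>.
\<close>

lemma permutes_adjacent_induct [consumes 1, case_names id adjacent]:
  assumes "p permutes {1..n}"
    and "P id"
    and step: "\<And>i q. i \<in> {1..<n} \<Longrightarrow> q permutes {1..n} \<Longrightarrow> P q \<Longrightarrow> P (transpose i (Suc i) \<circ> q)"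
  shows "P p"
proof -
  have seq: "P (apply_adj_transps xs \<circ> q)"
    if "set xs \<subseteq> {1..<n}" "q permutes {1..n}" "P q" for xs q
    using that(1)
  proof (induction xs)
    case Nil
    then show ?case using that by simp
  next
    case (Cons i xs)
    have "apply_adj_transps xs permutes {1..n}"
      using Cons.prems by (intro permutes_apply_adj_transps) auto
    then have "apply_adj_transps xs \<circ> q permutes {1..n}"
      using that(2) by (rule permutes_compose[rotated])
    then show ?case
      using Cons step[of i "apply_adj_transps xs \<circ> q"] by (simp add: comp_def)
  qed
  have less: "P (transpose a b \<circ> q)"
    if "a \<in> {1..n}" "b \<in> {1..n}" "a < b" "q permutes {1..n}" "P q" for a b q
    using seq[of "adj_transp_seq a b" q] that by (auto simp: set_adj_transp_seq adj_transp_seq_correct)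
  show ?thesis
    using assms(1) finite_atLeastAtMost
  proof (induction rule: permutes_induct)
    case id
    then show ?case by fact
  next
    case (swap a b q)
    then show ?case
      using less[of a b q] less[of b a q] by (metis nat_neq_iff transpose_commute)
  qed
qed

lemma actions_intertwined_if_adjacent:
  assumes \<phi>: "group_action (sym_group n) E \<phi>" and \<psi>: "group_action (sym_group n) F \<psi>"
    and hF: "h \<in> E \<rightarrow> F"
    and adj: "\<And>i x. i \<in> {1..<n} \<Longrightarrow> x \<in> E \<Longrightarrow>
      h (\<phi> (transpose i (Suc i)) x) = \<psi> (transpose i (Suc i)) (h x)"
    and \<sigma>: "\<sigma> \<in> carrier (sym_group n)" and "x \<in> E"
  shows "h (\<phi> \<sigma> x) = \<psi> \<sigma> (h x)"
proof -
  interpret E: group_action "sym_group n" E \<phi> by fact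
  interpret F: group_action "sym_group n" F \<psi> by fact
  have "\<sigma> permutes {1..n}"
    using \<sigma> by (simp add: sym_group_carrier)
  then show ?thesis
  proof (induction rule: permutes_adjacent_induct)
    case id
    have "\<phi> id x = x" "\<psi> id (h x) = h x"
      using hF \<open>x \<in> E\<close> by (auto simp flip: sym_group_one[of n] E.id_eq_one F.id_eq_one)
    then show ?case by (simp add: id_def)
  next
    case (adjacent i q)
    let ?t = "transpose i (Suc i)"
    have t: "?t \<in> carrier (sym_group n)" and q: "q \<in> carrier (sym_group n)"
      using adjacent by (auto simp: sym_group_carrier intro!: permutes_swap_id)
    have "h (\<phi> (?t \<circ> q) x) = h (\<phi> ?t (\<phi> q x))"
      using E.composition_rule[OF \<open>x \<in> E\<close> t q] by (simp add: sym_group_mult)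
    also have "\<dots> = \<psi> ?t (\<psi> q (h x))"
      using adjacent adj E.element_image[OF q \<open>x \<in> E\<close>] by simp
    also have "\<dots> = \<psi> (?t \<circ> q) (h x)"
      using F.composition_rule[OF funcset_mem[OF hF \<open>x \<in> E\<close>] t q] by (simp add: sym_group_mult)
    finally show ?case .
  qed
qed

section \<open>The canonical action\<close>

lemma group_action_canonical: "group_action (sym_group n) (cpow X n) (canonical_action X n)"
proof (rule group_actionI[OF sym_group_is_group])
  have inv_mem: "inv' \<sigma> i \<in> {1..n}" if "\<sigma> \<in> carrier (sym_group n)" "i \<in> {1..n}" for \<sigma> i
    using that permutes_in_image[OF permutes_inv] by (metis sym_group_carrier)
  show closed: "canonical_action X n \<sigma> x \<in> cpow X n"
    if "\<sigma> \<in> carrier (sym_group n)" "x \<in> cpow X n" for \<sigma> x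
    using that inv_mem[OF that(1)] unfolding canonical_action_def cpow_def by (auto simp: PiE_iff)
  show "canonical_action X n \<sigma> \<in> extensional (cpow X n)" for \<sigma>
    by (simp add: canonical_action_def)
  show "canonical_action X n \<one>\<^bsub>sym_group n\<^esub> x = x" if "x \<in> cpow X n" for x
    using that by (auto simp: canonical_action_def sym_group_one cpow_def PiE_iff fun_eq_iff
        extensional_def)
  show "canonical_action X n (\<sigma> \<otimes>\<^bsub>sym_group n\<^esub> \<rho>) x
      = canonical_action X n \<sigma> (canonical_action X n \<rho> x)"
    if \<sigma>: "\<sigma> \<in> carrier (sym_group n)" and \<rho>: "\<rho> \<in> carrier (sym_group n)"
      and x: "x \<in> cpow X n" for \<sigma> \<rho> x
  proof -
    have "inv' (\<sigma> \<circ> \<rho>) = inv' \<rho> \<circ> inv' \<sigma>"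
      using \<sigma> \<rho> by (simp add: sym_group_carrier permutes_bij o_inv_distrib)
    then show ?thesis
      using closed[OF \<rho> x] inv_mem[OF \<sigma>] x
      by (auto simp: canonical_action_def sym_group_mult fun_eq_iff)
  qed
qed

section \<open>Components of the maps involved\<close>

lemma S_adj_apply:
  assumes "x \<in> cpow X n"
  shows "S_adj X S n i x k =
    (if k = Suc i then f_map S (x (Suc i)) (x i)
     else if k = i then g_map S (x i) (x (Suc i)) else x k)"
  using assms by (simp add: S_adj_def f_map_def g_map_def)

lemma S_adj_closed:
  assumes "S \<in> X \<times> X \<rightarrow> X \<times> X" "x \<in> cpow X n" "i \<in> {1..<n}"
  shows "S_adj X S n i x \<in> cpow X n"
proof -
  have "x i \<in> X" "x (Suc i) \<in> X"
    using assms(2,3) by (auto simp: cpow_def PiE_iff)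
  then have "S (x i, x (Suc i)) \<in> X \<times> X"
    using assms(1) by blast
  then show ?thesis
    using assms(2,3) by (auto simp: S_adj_def cpow_def PiE_iff extensional_def mem_Times_iff)
qed

lemma J_map_apply:
  assumes "x \<in> cpow X n" "i \<in> {1..n}"
  shows "J_map X S n x i = fold (\<lambda>j. f_map S (x j)) [Suc i..<Suc n] (x i)"
  using assms by (simp add: J_map_def del: upt_Suc)

text \<open>
  This is the last component of the braid relation at \<open>(a, b, c)\<close>. It makes the composite \<open>f\<^sub>c f\<^sub>b\<close> invariant under replacing \<open>(b, c)\<close> by \<open>S (b, c)\<close>.
\<close>

lemma f_map_braided:
  assumes br: "braided X S" and S: "S \<in> X \<times> X \<rightarrow> X \<times> X"
    and X: "a \<in> X" "b \<in> X" "c \<in> X"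
  shows "f_map S (f_map S c b) (f_map S (g_map S b c) a) = f_map S c (f_map S b a)"
proof -
  define x where "x = (\<lambda>i\<in>{1..3::nat}. if i = 1 then a else if i = 2 then b else c)"
  have x: "x \<in> cpow X 3"
    using X by (auto simp: x_def cpow_def)
  have vals: "x (Suc 0) = a" "x 2 = b" "x 3 = c"
    by (simp_all add: x_def)
  note closed = S_adj_closed[OF S]
  have "S_adj X S 3 1 (S_adj X S 3 2 (S_adj X S 3 1 x)) 3
      = S_adj X S 3 2 (S_adj X S 3 1 (S_adj X S 3 2 x)) 3"
    using br x by (simp add: braided_def)
  then show ?thesis
    using x by (simp add: S_adj_apply closed vals flip: numeral_2_eq_2 numeral_3_eq_3)
qed

lemma f_map_g_map_involutive:
  assumes "involutive X S" "a \<in> X" "b \<in> X"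
  shows "f_map S (f_map S b a) (g_map S a b) = b"
  using assms by (simp add: involutive_def f_map_def g_map_def)

section \<open>The map \<open>J\<close> is bijective\<close>

lemma bij_betw_fold:
  assumes "\<And>j. j \<in> set js \<Longrightarrow> bij_betw (f j) X X"
  shows "bij_betw (fold f js) X X"
  using assms
proof (induction js)
  case Nil
  then show ?case by (simp add: bij_betw_def)
next
  case (Cons j js)
  then show ?case
    using bij_betw_trans[of "f j" X X "fold f js" X] by (simp add: comp_def)
qed

lemma bij_betw_J_map_component:
  assumes "\<And>y. y \<in> X \<Longrightarrow> bij_betw (f_map S y) X X" "x \<in> cpow X n"
  shows "bij_betw (fold (\<lambda>j. f_map S (x j)) [Suc i..<Suc n]) X X"
  using assms by (intro bij_betw_fold) (auto simp: cpow_def PiE_iff)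

lemma J_map_closed:
  assumes f: "\<And>y. y \<in> X \<Longrightarrow> bij_betw (f_map S y) X X" and x: "x \<in> cpow X n"
  shows "J_map X S n x \<in> cpow X n"
proof -
  have "fold (\<lambda>j. f_map S (x j)) [Suc i..<Suc n] (x i) \<in> X" if "i \<in> {1..n}" for i
    using bij_betwE[OF bij_betw_J_map_component[OF f x, of i]] x that
    by (auto simp: cpow_def PiE_iff)
  then show ?thesis
    using x by (auto simp: J_map_def cpow_def simp del: upt_Suc)
qed

text \<open>
  Triangularity: once two preimages agree to the right of \<open>i\<close>, the same bijection is applied to
  their components \<open>i\<close>.
\<close>

lemma inj_on_J_map:
  assumes f: "\<And>y. y \<in> X \<Longrightarrow> bij_betw (f_map S y) X X"
  shows "inj_on (J_map X S n) (cpow X n)"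
proof (rule inj_onI)
  fix x y assume x: "x \<in> cpow X n" and y: "y \<in> cpow X n" and eq: "J_map X S n x = J_map X S n y"
  have "x i = y i" if "i \<in> {1..n}" for i
    using that
  proof (induction "n - i" arbitrary: i rule: less_induct)
    case less
    have agree: "x j = y j" if "j \<in> {Suc i..<Suc n}" for j
      using less.hyps[of j] less.prems that by auto
    let ?F = "fold (\<lambda>j. f_map S (x j)) [Suc i..<Suc n]"
    have "?F (y i) = fold (\<lambda>j. f_map S (y j)) [Suc i..<Suc n] (y i)"
      using agree by (intro fold_cong) (simp_all del: upt_Suc)
    then have "?F (x i) = ?F (y i)"
      using eq x y less.prems by (metis J_map_apply)
    moreover have "x i \<in> X" "y i \<in> X"
      using x y less.prems by (auto simp: cpow_def PiE_iff)
    ultimately show ?case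
      using bij_betw_J_map_component[OF f x, of i] by (auto simp: bij_betw_def inj_on_def)
  qed
  then show "x = y"
    using x y unfolding cpow_def by (intro PiE_ext) auto
qed

text \<open>
  A preimage is built from right to left: changing component \<open>i\<close> affects the components of \<open>J x\<close> only
  from \<open>i\<close> leftwards, so it can be used to correct component \<open>i\<close> without spoiling those already
  correct.
\<close>

lemma J_map_surj:
  assumes f: "\<And>y. y \<in> X \<Longrightarrow> bij_betw (f_map S y) X X" and y: "y \<in> cpow X n"
  obtains x where "x \<in> cpow X n" "J_map X S n x = y"
proof -
  have "\<exists>x\<in>cpow X n. \<forall>i\<in>{Suc m..n}. J_map X S n x i = y i" if "m \<le> n" for m
    using that
  proof (induction m rule: inc_induct)
    case base
    show ?case using y by auto
  next
    case (step m)
    then obtain x where x: "x \<in> cpow X n"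
      and Jx: "\<And>i. i \<in> {Suc (Suc m)..n} \<Longrightarrow> J_map X S n x i = y i"
      by blast
    let ?F = "fold (\<lambda>j. f_map S (x j)) [Suc (Suc m)..<Suc n]"
    have "y (Suc m) \<in> X"
      using y step by (auto simp: cpow_def PiE_iff)
    then obtain a where a: "a \<in> X" "?F a = y (Suc m)"
      using bij_betw_imp_surj_on[OF bij_betw_J_map_component[OF f x, of "Suc m"]]
      by (metis imageE)
    define x' where "x' = x(Suc m := a)"
    have x': "x' \<in> cpow X n"
      using x a step by (auto simp: x'_def cpow_def PiE_iff extensional_def)
    have "J_map X S n x' i = y i" if i: "i \<in> {Suc m..n}" for i
    proof -
      have F: "fold (\<lambda>j. f_map S (x' j)) [Suc i..<Suc n] = fold (\<lambda>j. f_map S (x j)) [Suc i..<Suc n]"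
        using i by (intro ext fold_cong) (auto simp: x'_def simp del: upt_Suc)
      have J: "J_map X S n x' i = fold (\<lambda>j. f_map S (x j)) [Suc i..<Suc n] (x' i)"
        using J_map_apply[OF x', of i S] i F by (simp del: upt_Suc)
      show ?thesis
      proof (cases "i = Suc m")
        case True
        then show ?thesis using J a by (simp add: x'_def del: upt_Suc)
      next
        case False
        then have "J_map X S n x' i = J_map X S n x i"
          using J J_map_apply[OF x, of i S] i by (simp add: x'_def del: upt_Suc)
        then show ?thesis using Jx i False by simp
      qed
    qed
    then show ?case using x' by blast
  qed
  from this[of 0] obtain x where x: "x \<in> cpow X n" "\<And>i. i \<in> {1..n} \<Longrightarrow> J_map X S n x i = y i"
    by auto
  have "J_map X S n x = y"
    using J_map_closed[OF f x(1)] y x(2) unfolding cpow_def by (intro PiE_ext) auto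
  with x(1) show thesis by (rule that)
qed

lemma bij_betw_J_map:
  assumes f: "\<And>y. y \<in> X \<Longrightarrow> bij_betw (f_map S y) X X"
  shows "bij_betw (J_map X S n) (cpow X n) (cpow X n)"
  unfolding bij_betw_def
proof (intro conjI equalityI subsetI)
  show "inj_on (J_map X S n) (cpow X n)"
    using f by (rule inj_on_J_map)
  show "y \<in> cpow X n" if "y \<in> J_map X S n ` cpow X n" for y
    using that f J_map_closed by blast
  show "y \<in> J_map X S n ` cpow X n" if "y \<in> cpow X n" for y
    using J_map_surj[OF f that] by blast
qed

section \<open>The map \<open>J\<close> intertwines the generators\<close>

text \<open>
  Write \<open>(b, c) = (x i, x (i+1))\<close>. Left of \<open>i\<close> the indices \<open>b\<close> and \<open>c\<close> of two consecutive \<open>f\<close> are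
  replaced by \<open>g\<^sub>b c\<close> and \<open>f\<^sub>c b\<close>, which does not change their composite. Component \<open>i + 1\<close> of the
  new tuple, \<open>f\<^sub>c b\<close>, is already the first step of the former component \<open>i\<close> of \<open>J x\<close>; the first
  step of the new component \<open>i\<close> recovers \<open>c\<close>, by involutivity.
\<close>

lemma J_map_S_adj:
  assumes br: "braided X S" and inv: "involutive X S" and S: "S \<in> X \<times> X \<rightarrow> X \<times> X"
    and f: "\<And>y. y \<in> X \<Longrightarrow> bij_betw (f_map S y) X X"
    and x: "x \<in> cpow X n" and i: "i \<in> {1..<n}"
  shows "J_map X S n (S_adj X S n i x) = canonical_action X n (transpose i (Suc i)) (J_map X S n x)"
proof -
  define x' where "x' = S_adj X S n i x"
  define F where "F x k = fold (\<lambda>j. f_map S (x j)) [k..<Suc n]" for x :: "nat \<Rightarrow> 'a" and k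
  have x': "x' \<in> cpow X n"
    using S_adj_closed[OF S x i] by (simp add: x'_def)
  have x'_i: "x' i = g_map S (x i) (x (Suc i))" and x'_Suc: "x' (Suc i) = f_map S (x (Suc i)) (x i)"
    and x'_other: "\<And>k. k \<noteq> i \<Longrightarrow> k \<noteq> Suc i \<Longrightarrow> x' k = x k"
    by (simp_all add: x'_def S_adj_apply[OF x])
  have xX: "x k \<in> X" if "k \<in> {1..n}" for k
    using x that by (auto simp: cpow_def PiE_iff)
  have bc: "x i \<in> X" "x (Suc i) \<in> X"
    using xX i by auto
  have J: "J_map X S n z k = F z (Suc k) (z k)" if "z \<in> cpow X n" "k \<in> {1..n}" for z k
    using that by (simp add: J_map_apply F_def del: upt_Suc)
  have F_step: "F z k = F z (Suc k) \<circ> f_map S (z k)" if "k \<le> n" for z k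
    using that by (simp add: F_def upt_conv_Cons del: upt_Suc)
  have F_right: "F x' k = F x k" if "Suc i < k" for k
    unfolding F_def using that x'_other by (intro ext fold_cong) (auto simp del: upt_Suc)
  have F_left: "F x' (Suc k) a = F x (Suc k) a" if k: "k < i" and a: "a \<in> X" for k a
  proof -
    let ?G = "fold (\<lambda>j. f_map S (x j)) [Suc k..<i]"
    have split: "F z (Suc k) a =
        F z (Suc (Suc i)) (f_map S (z (Suc i)) (f_map S (z i)
          (fold (\<lambda>j. f_map S (z j)) [Suc k..<i] a)))" for z
    proof -
      have "[Suc k..<Suc n] = [Suc k..<i] @ i # Suc i # [Suc (Suc i)..<Suc n]"
        using k i upt_add_eq_append[of "Suc k" i "Suc n - i"]
        by (simp add: upt_conv_Cons del: upt_Suc)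
      then show ?thesis by (simp add: F_def del: upt_Suc)
    qed
    have "fold (\<lambda>j. f_map S (x' j)) [Suc k..<i] = ?G"
      using x'_other by (intro ext fold_cong) auto
    moreover have "bij_betw ?G X X"
      using f xX i k by (intro bij_betw_fold) auto
    then have "?G a \<in> X"
      using a by (rule bij_betw_apply)
    ultimately show ?thesis
      using f_map_braided[OF br S _ bc, of "?G a"]
      by (simp add: split F_right x'_i x'_Suc)
  qed
  have "J_map X S n x' k = ((J_map X S n x)(i := J_map X S n x (Suc i), Suc i := J_map X S n x i)) k"
    if k: "k \<in> {1..n}" for k
  proof -
    consider "k < i" | "k = i" | "k = Suc i" | "Suc i < k" by linarith
    then show ?thesis
    proof cases
      case 1
      then show ?thesis using F_left xX x'_other k by (simp add: J x x')
    next
      case 2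
      then show ?thesis
        using i f_map_g_map_involutive[OF inv bc]
        by (simp add: J x x' F_step F_right x'_i x'_Suc)
    next
      case 3
      then show ?thesis
        using i by (simp add: J x x' F_step F_right x'_Suc)
    next
      case 4
      then show ?thesis using F_right x'_other k by (simp add: J x x')
    qed
  qed
  moreover have "J_map X S n x \<in> cpow X n" "J_map X S n x' \<in> cpow X n"
    using J_map_closed[OF f] x x' by blast+
  ultimately show ?thesis
    using i unfolding x'_def[symmetric] canonical_action_adjacent[OF i \<open>J_map X S n x \<in> cpow X n\<close>]
    by (intro extensionalityI[of _ "{1..n}"]) (auto simp: cpow_def PiE_iff extensional_def)
qed

section \<open>The twisted and canonical actions are isomorphic\<close>

theorem corollary1p8:
  fixes X :: "'a set" and S :: "'a \<times> 'a \<Rightarrow> 'a \<times> 'a" and n :: nat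
  assumes "X \<noteq> {}"
    and "bij_betw S (X \<times> X) (X \<times> X)"
    and "nondegenerate X S"
    and "symmetric_set X S"
    and "n \<ge> 1"
  shows "(\<exists>\<tau>. is_twisted_action X S n \<tau>) \<and>
    (\<forall>\<tau>. is_twisted_action X S n \<tau> \<longrightarrow>
      conjugates_action (sym_group n) (cpow X n) \<tau> (cpow X n) (canonical_action X n) (J_map X S n) \<and>
      isomorphic_actions (sym_group n) (cpow X n) \<tau> (cpow X n) (canonical_action X n))"
proof -
  let ?J = "J_map X S n" and ?E = "cpow X n" and ?c = "canonical_action X n"
  have S: "S \<in> X \<times> X \<rightarrow> X \<times> X"
    using assms(2) by (rule bij_betw_imp_funcset)
  have f: "bij_betw (f_map S y) X X" if "y \<in> X" for y
    using assms(3) that by (simp add: nondegenerate_def)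
  have br: "braided X S" and inv: "involutive X S"
    using assms(4) by (simp_all add: symmetric_set_def)
  have J: "bij_betw ?J ?E ?E"
    using f by (rule bij_betw_J_map)
  have J_adj: "?J (S_adj X S n i x) = ?c (transpose i (Suc i)) (?J x)"
    if "i \<in> {1..<n}" "x \<in> ?E" for i x
    using J_map_S_adj[OF br inv S f that(2,1)] .
  define \<tau> where "\<tau> = (\<lambda>\<sigma>. \<lambda>x\<in>?E. inv_into ?E ?J (?c \<sigma> (?J x)))"
  have "\<tau> (transpose i (Suc i)) = S_adj X S n i" if i: "i \<in> {1..<n}" for i
  proof (rule extensionalityI[of _ ?E])
    show "\<tau> (transpose i (Suc i)) x = S_adj X S n i x" if "x \<in> ?E" for x
      using that J_adj[OF i that] bij_betw_inv_into_left[OF J S_adj_closed[OF S that i]]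
      by (simp add: \<tau>_def)
  qed (simp_all add: \<tau>_def S_adj_def)
  moreover have "group_action (sym_group n) ?E \<tau>"
    unfolding \<tau>_def by (rule group_action_pullback[OF group_action_canonical J])
  ultimately have "is_twisted_action X S n \<tau>"
    by (simp add: is_twisted_action_def)
  moreover have "conjugates_action (sym_group n) ?E \<tau> ?E ?c ?J"
    if tw: "is_twisted_action X S n \<tau>" for \<tau>
  proof -
    have act: "group_action (sym_group n) ?E \<tau>"
      and adj: "\<And>i. i \<in> {1..<n} \<Longrightarrow> \<tau> (transpose i (Suc i)) = S_adj X S n i"
      using tw by (simp_all add: is_twisted_action_def)
    have "?J (\<tau> \<sigma> x) = ?c \<sigma> (?J x)" if "\<sigma> \<in> carrier (sym_group n)" "x \<in> ?E" for \<sigma> x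
      by (rule actions_intertwined_if_adjacent[OF act group_action_canonical
            bij_betw_imp_funcset[OF J] _ that]) (simp add: adj J_adj)
    then show ?thesis
      using act group_action_canonical J by (simp add: conjugates_action_def)
  qed
  ultimately show ?thesis
    unfolding isomorphic_actions_def by blast
qed

end
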